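(* Let $n \geq 2$ and $d \geq 1$ be integers and let $M$ be a $k \times n$ matrix with entries in $\mathbb{Z}_{d+1}$. For nonnegative integers $e_1,\dots,e_d$ with $0 \leq e_1 + \dots + e_d \leq k$, let $y_{e_1,\dots,e_d}$ denote the number of columns of $M$ that contain exactly $e_s$ occurrences of $s$ for each $s \in \{1,\dots,d\}$. For each $i = 1,\dots,k$, player $i$ sees all of $M$ except row $i$. If $k \geq 4^d \log n$, then there exists a deterministic simultaneous Number-On-the-Forehead protocol of cost at most $k \binom{k+d}{d} \lceil \log n \rceil$ at the end of which the referee knows all the numbers $y_{e_1,\dots,e_d}$.
   Context: Logarithms are base 2. $\mathbb{Z}_{d+1} = \{0,\dots,d\}$. Deterministic simultaneous Number-On-the-Forehead model: each of the $k$ players, without communicating with the other players, sends a message depending deterministically on what she sees (here, all rows of $M$ except her own row) to a referee who sees nothing of $M$; the referee must then determine the required output from the messages alone. The cost is the worst-case total number of bits sent to the referee. *)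

theory Defs
  imports Complex_Main "HOL-Library.Sublist" "Jordan_Normal_Form.Matrix"
begin

definition input_mats :: "nat \<Rightarrow> nat \<Rightarrow> nat \<Rightarrow> nat mat set" where
  "input_mats k n d = {M \<in> carrier_mat k n. elements_mat M \<subseteq> {0..d}}"

lemma finite_input_mats: "finite (input_mats k n d)"
proof (rule finite_subset)
  let ?F = "({..<k} \<times> {..<n}) \<rightarrow>\<^sub>E {0..d}"
  show "input_mats k n d \<subseteq> mat k n ` ?F"
  proof
    fix M assume M: "M \<in> input_mats k n d"
    let ?f = "restrict (($$) M) ({..<k} \<times> {..<n})"
    have "M = mat k n ?f"
      using M by (intro eq_matI) (auto simp: input_mats_def)
    moreover have "?f \<in> ?F"
    proof (intro restrict_PiE_iff[THEN iffD2] ballI)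
      fix p assume "p \<in> {..<k} \<times> {..<n}"
      then have "M $$ p \<in> elements_mat M"
        using M by (auto simp: input_mats_def intro!: elements_matI)
      then show "M $$ p \<in> {0..d}"
        using M by (auto simp: input_mats_def)
    qed
    ultimately show "M \<in> mat k n ` ?F"
      by blast
  qed
  show "finite (mat k n ` ?F)"
    by (intro finite_imageI finite_PiE) auto
qed

lemma input_mats_nonempty: "input_mats k n d \<noteq> {}"
proof -
  have "0\<^sub>m k n \<in> input_mats k n d"
    using elements_0_mat[of k n, where ?'a = nat] by (auto simp: input_mats_def)
  then show ?thesis
    by blast
qed

text \<open>The number \<open>y\<^bsub>e\<^sub>1,\<dots>,e\<^sub>d\<^esub>\<close>; only the values of \<open>e\<close> on \<open>{1..d}\<close> matter.\<close>

definition col_count :: "nat \<Rightarrow> nat mat \<Rightarrow> (nat \<Rightarrow> nat) \<Rightarrow> nat" where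
  "col_count d M e =
     card {c. c < dim_col M \<and>
              (\<forall>s\<in>{1..d}. card {r. r < dim_row M \<and> M $$ (r, c) = s} = e s)}"

text \<open>Players are indexed by the rows \<open>0, \<dots>, k - 1\<close>. A message is a string of bits, and the
  referee is a function of the list of the \<open>k\<close> messages alone.\<close>

record 'out sim_protocol =
  message :: "nat \<Rightarrow> nat mat \<Rightarrow> bool list"
  referee :: "bool list list \<Rightarrow> 'out"

definition all_messages :: "nat \<Rightarrow> 'out sim_protocol \<Rightarrow> nat mat \<Rightarrow> bool list list" where
  "all_messages k P M = map (\<lambda>i. message P i M) [0..<k]"

definition protocol_output :: "nat \<Rightarrow> 'out sim_protocol \<Rightarrow> nat mat \<Rightarrow> 'out" where
  "protocol_output k P M = referee P (all_messages k P M)"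

text \<open>Messages of varying length are allowed, but the messages of each player form a prefix code
  (as for the leaves of a protocol tree). Otherwise the positions where the messages end would
  give the referee information that is not counted in the number of bits sent.\<close>

definition sim_NOF_protocol :: "nat \<Rightarrow> nat \<Rightarrow> nat \<Rightarrow> 'out sim_protocol \<Rightarrow> bool" where
  "sim_NOF_protocol k n d P \<longleftrightarrow>
     (\<forall>i<k. \<forall>M\<in>input_mats k n d. \<forall>M'\<in>input_mats k n d.
        ((\<forall>j<k. j \<noteq> i \<longrightarrow> row M j = row M' j) \<longrightarrow> message P i M = message P i M') \<and>
        (prefix (message P i M) (message P i M') \<longrightarrow> message P i M = message P i M'))"

definition protocol_cost :: "nat \<Rightarrow> nat \<Rightarrow> nat \<Rightarrow> 'out sim_protocol \<Rightarrow> nat" where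
  "protocol_cost k n d P =
     Max ((\<lambda>M. sum_list (map length (all_messages k P M))) ` input_mats k n d)"

end

theory Submission
  imports Defs
begin

text \<open>
  The type of a column is the multiset of its entries. Player \<open>i\<close> sends the histogram of the
  column types with row \<open>i\<close> removed. Summed over all players, the number of columns seen with type
  \<open>N\<close> is \<open>\<Sum>s. (count N s + 1) * y (N + {s})\<close>, so the difference \<open>z\<close> of two histograms \<open>y\<close>
  compatible with the same messages satisfies the homogeneous linear system \<open>balanced\<close>.
  It remains to see that a nonzero integer solution has \<open>\<ell>\<^sub>1\<close> norm greater than \<open>2n\<close>,
  whereas \<open>z\<close> has norm at most \<open>2n\<close>.

  Fix a symbol \<open>a\<close> and let \<open>w t\<close> be the norm of the part of \<open>z\<close> on the types containing \<open>a\<close>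
  exactly \<open>t\<close> times. The system gives \<open>(t + 1) * w (t + 1) \<le> (k - t) * w t\<close>, so
  \<open>w t / (k choose t)\<close> is decreasing. Let \<open>j\<close> be the largest index with a nonzero slice; this slice
  solves the system with one symbol less and \<open>k - j\<close> rows. If \<open>j \<le> 3k/4\<close>, use induction on
  the number of symbols, which costs a factor 4 in the exponent. Otherwise the norm of \<open>z\<close> is at
  least \<open>(\<Sum>t\<le>j. k choose t) / (k choose j)\<close>, which is exponential in \<open>k\<close>.
\<close>

section \<open>Double counting over multisets of fixed size\<close>

lemma sum_count_multisets_of_size:
  assumes "finite A" "X \<in> multisets_of_size A n"
  shows "(\<Sum>x\<in>A. count X x) = n"
proof -
  have "(\<Sum>x\<in>A. count X x) = size X"
    unfolding size_multiset_overloaded_eq using assms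
    by (intro sum.mono_neutral_right) (auto simp: multisets_of_size_def not_in_iff)
  then show ?thesis
    using assms by (simp add: multisets_of_size_def)
qed

text \<open>A multiset \<open>T\<close> arises as \<open>add_mset s N\<close> exactly once for each
  of its distinct symbols \<open>s\<close>, with weight \<open>count T s\<close>; these weights add
  up to its size \<open>Suc m\<close>.\<close>

lemma sum_add_mset_weighted:
  fixes f :: "'a multiset \<Rightarrow> real"
  assumes A: "finite A"
  shows "(\<Sum>N\<in>multisets_of_size A m. \<Sum>s\<in>A. real (Suc (count N s)) * f (add_mset s N))
       = real (Suc m) * (\<Sum>T\<in>multisets_of_size A (Suc m). f T)"
proof -
  have fin: "finite (multisets_of_size A l)" for l
    using A by blast
  have one: "(\<Sum>N\<in>multisets_of_size A m. real (Suc (count N s)) * f (add_mset s N))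
      = (\<Sum>T\<in>multisets_of_size A (Suc m). real (count T s) * f T)" if "s \<in> A" for s
  proof -
    have "(\<Sum>N\<in>multisets_of_size A m. real (Suc (count N s)) * f (add_mset s N))
        = (\<Sum>T\<in>{T\<in>multisets_of_size A (Suc m). s \<in># T}. real (count T s) * f T)"
      using that
      by (intro sum.reindex_bij_witness[of _ "\<lambda>T. T - {#s#}" "add_mset s"])
        (auto simp: multisets_of_size_def size_Diff_singleton dest: in_diffD)
    also have "\<dots> = (\<Sum>T\<in>multisets_of_size A (Suc m). real (count T s) * f T)"
      by (intro sum.mono_neutral_left) (auto simp: fin not_in_iff)
    finally show ?thesis .
  qed
  have "(\<Sum>N\<in>multisets_of_size A m. \<Sum>s\<in>A. real (Suc (count N s)) * f (add_mset s N))
      = (\<Sum>s\<in>A. \<Sum>T\<in>multisets_of_size A (Suc m). real (count T s) * f T)"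
    by (subst sum.swap) (intro sum.cong refl one)
  also have "\<dots> = (\<Sum>T\<in>multisets_of_size A (Suc m). real (\<Sum>s\<in>A. count T s) * f T)"
    by (subst sum.swap) (simp add: sum_distrib_right)
  also have "\<dots> = (\<Sum>T\<in>multisets_of_size A (Suc m). real (Suc m) * f T)"
  proof (intro sum.cong refl)
    fix T assume T: "T \<in> multisets_of_size A (Suc m)"
    show "real (\<Sum>s\<in>A. count T s) * f T = real (Suc m) * f T"
      by (simp only: sum_count_multisets_of_size[OF A T])
  qed
  finally show ?thesis
    by (simp add: sum_distrib_left)
qed

section \<open>The linear system, its norm and its slices\<close>

text \<open>The coefficient counts the rows of a column of type \<open>add_mset s N\<close> whose
  deletion leaves \<open>N\<close>. Stating the size with \<open>Suc\<close> leaves no equations for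
  \<open>k = 0\<close>, where \<open>k - 1\<close> would truncate.\<close>

definition balanced :: "'a set \<Rightarrow> nat \<Rightarrow> ('a multiset \<Rightarrow> int) \<Rightarrow> bool" where
  "balanced A k z \<longleftrightarrow>
     (\<forall>N. set_mset N \<subseteq> A \<and> Suc (size N) = k \<longrightarrow>
        (\<Sum>s\<in>A. int (Suc (count N s)) * z (add_mset s N)) = 0)"

definition l1norm :: "'a set \<Rightarrow> nat \<Rightarrow> ('a multiset \<Rightarrow> int) \<Rightarrow> real" where
  "l1norm A k z = (\<Sum>N\<in>multisets_of_size A k. \<bar>real_of_int (z N)\<bar>)"

definition slice :: "'a \<Rightarrow> nat \<Rightarrow> ('a multiset \<Rightarrow> int) \<Rightarrow> 'a multiset \<Rightarrow> int" where
  "slice a t z N = z (N + replicate_mset t a)"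

lemma l1norm_nonneg: "l1norm A k z \<ge> 0"
  by (auto simp: l1norm_def intro: sum_nonneg)

text \<open>Integrality of \<open>z\<close> enters here: a nonzero value has absolute value at least
  1.\<close>

lemma l1norm_ge_1:
  assumes "finite A" "N \<in> multisets_of_size A k" "z N \<noteq> 0"
  shows "l1norm A k z \<ge> 1"
proof -
  have "1 \<le> \<bar>real_of_int (z N)\<bar>"
    using assms(3) by linarith
  also have "\<dots> \<le> l1norm A k z"
    unfolding l1norm_def using assms by (intro member_le_sum) auto
  finally show ?thesis .
qed

lemma l1norm_insert:
  assumes "finite B" "a \<notin> B"
  shows "l1norm (insert a B) k z = (\<Sum>t\<le>k. l1norm B (k - t) (slice a t z))"
proof -
  have "l1norm (insert a B) k z
      = (\<Sum>(t, N)\<in>(SIGMA t:{0..k}. multisets_of_size B (k - t)). \<bar>real_of_int (slice a t z N)\<bar>)"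
    unfolding l1norm_def slice_def
    using sum.reindex_bij_betw[OF bij_betw_multisets_of_size_insert[OF assms(2), of k],
        of "\<lambda>N. \<bar>real_of_int (z N)\<bar>"]
    by (simp add: case_prod_unfold)
  also have "\<dots> = (\<Sum>t\<le>k. l1norm B (k - t) (slice a t z))"
    unfolding l1norm_def using assms(1)
    by (subst sum.Sigma[symmetric]) (auto simp: atMost_atLeast0)
  finally show ?thesis .
qed

text \<open>This is the equation at \<open>N\<close> with \<open>t\<close> copies of
  \<open>a\<close> added, solved for the summand \<open>s = a\<close>. Its coefficient is
  \<open>Suc t\<close> because \<open>a\<close> does not occur in \<open>N\<close>.\<close>

lemma balanced_slice_eq:
  assumes "balanced (insert a B) k z" "finite B" "a \<notin> B"
    and "set_mset N \<subseteq> B" "Suc (size N + t) = k"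
  shows "int (Suc t) * slice a (Suc t) z N
       = - (\<Sum>s\<in>B. int (Suc (count N s)) * slice a t z (add_mset s N))"
proof -
  have "a \<notin># N"
    using assms by auto
  have "(\<Sum>s\<in>insert a B. int (Suc (count (N + replicate_mset t a) s))
            * z (add_mset s (N + replicate_mset t a))) = 0"
    using assms(1) unfolding balanced_def
    by (rule allE[of _ "N + replicate_mset t a"], elim mp)
      (use assms(4,5) in \<open>auto split: if_splits\<close>)
  moreover have "(\<Sum>s\<in>B. int (Suc (count (N + replicate_mset t a) s))
            * z (add_mset s (N + replicate_mset t a)))
      = (\<Sum>s\<in>B. int (Suc (count N s)) * slice a t z (add_mset s N))"
    using assms(3) by (intro sum.cong) (auto simp: slice_def)
  moreover have "count N a = 0"
    using \<open>a \<notin># N\<close> by (simp add: not_in_iff)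
  ultimately show ?thesis
    using assms(2,3) by (simp add: slice_def)
qed

text \<open>If the next slice vanishes, the left side of \<open>balanced_slice_eq\<close> is zero,
  and what remains is the system without \<open>a\<close>.\<close>

lemma balanced_slice:
  assumes bal: "balanced (insert a B) k z" and B: "finite B" "a \<notin> B" and "t \<le> k"
    and zero: "\<And>N. N \<in> multisets_of_size B (k - Suc t) \<Longrightarrow> slice a (Suc t) z N = 0"
  shows "balanced B (k - t) (slice a t z)"
  unfolding balanced_def
proof (intro allI impI)
  fix N assume N: "set_mset N \<subseteq> B \<and> Suc (size N) = k - t"
  have "slice a (Suc t) z N = 0"
    using N by (intro zero) (auto simp: multisets_of_size_def)
  moreover have "int (Suc t) * slice a (Suc t) z N
       = - (\<Sum>s\<in>B. int (Suc (count N s)) * slice a t z (add_mset s N))"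
    using N by (intro balanced_slice_eq[OF bal B]) auto
  ultimately show "(\<Sum>s\<in>B. int (Suc (count N s)) * slice a t z (add_mset s N)) = 0"
    by simp
qed

text \<open>The triangle inequality in \<open>balanced_slice_eq\<close>, followed by double
  counting. The factor \<open>k - t\<close> is the size of the multisets in slice
  \<open>t\<close>.\<close>

lemma l1norm_slice_Suc:
  assumes bal: "balanced (insert a B) k z" and B: "finite B" "a \<notin> B" and t: "t < k"
  shows "real (Suc t) * l1norm B (k - Suc t) (slice a (Suc t) z)
       \<le> real (k - t) * l1norm B (k - t) (slice a t z)"
proof -
  have "real (Suc t) * \<bar>real_of_int (slice a (Suc t) z N)\<bar>
      \<le> (\<Sum>s\<in>B. real (Suc (count N s)) * \<bar>real_of_int (slice a t z (add_mset s N))\<bar>)"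
    if N: "N \<in> multisets_of_size B (k - Suc t)" for N
  proof -
    have "int (Suc t) * slice a (Suc t) z N
       = - (\<Sum>s\<in>B. int (Suc (count N s)) * slice a t z (add_mset s N))"
      using N t by (intro balanced_slice_eq[OF bal B]) (auto simp: multisets_of_size_def)
    from arg_cong[OF this, of "\<lambda>x. \<bar>real_of_int x\<bar>"]
    have "real (Suc t) * \<bar>real_of_int (slice a (Suc t) z N)\<bar>
        = \<bar>\<Sum>s\<in>B. real (Suc (count N s)) * real_of_int (slice a t z (add_mset s N))\<bar>"
      by (simp add: abs_mult)
    also have "\<dots> \<le> (\<Sum>s\<in>B. \<bar>real (Suc (count N s)) * real_of_int (slice a t z (add_mset s N))\<bar>)"
      by (rule sum_abs)
    finally show ?thesis
      by (simp add: abs_mult)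
  qed
  then have "real (Suc t) * l1norm B (k - Suc t) (slice a (Suc t) z)
      \<le> (\<Sum>N\<in>multisets_of_size B (k - Suc t). \<Sum>s\<in>B.
            real (Suc (count N s)) * \<bar>real_of_int (slice a t z (add_mset s N))\<bar>)"
    unfolding l1norm_def sum_distrib_left by (intro sum_mono)
  also have "\<dots> = real (k - t) * l1norm B (k - t) (slice a t z)"
    using t unfolding l1norm_def by (subst sum_add_mset_weighted[OF B(1)]) (simp add: Suc_diff_Suc)
  finally show ?thesis .
qed

text \<open>The factors in \<open>l1norm_slice_Suc\<close> are those of the absorption identity
  \<open>(j + 1) * (k choose (j + 1)) = (k - j) * (k choose j)\<close>, so dividing by the binomials
  cancels them.\<close>

lemma l1norm_slice_div_binomial_antimono:
  assumes bal: "balanced (insert a B) k z" and B: "finite B" "a \<notin> B"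
    and "t \<le> j" "j \<le> k"
  shows "l1norm B (k - j) (slice a j z) / real (k choose j)
       \<le> l1norm B (k - t) (slice a t z) / real (k choose t)"
  using assms(4,5)
proof (induction j rule: dec_induct)
  case (step j)
  have c: "real (Suc j) * real (k choose Suc j) = real (k - j) * real (k choose j)"
    using step.prems
    by (metis binomial_absorb_comp binomial_absorption of_nat_mult)
  have pos: "real (k choose Suc j) > 0" "real (k choose j) > 0"
    using step.prems by auto
  have "real (Suc j) * (l1norm B (k - Suc j) (slice a (Suc j) z) * real (k choose j))
      \<le> real (k - j) * l1norm B (k - j) (slice a j z) * real (k choose j)"
    using l1norm_slice_Suc[OF bal B, of j] step.prems pos
    by (simp only: mult.assoc[symmetric] mult_right_mono Suc_le_eq less_imp_le)
  also have "\<dots> = real (Suc j) * (l1norm B (k - j) (slice a j z) * real (k choose Suc j))"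
    using arg_cong[OF c, of "\<lambda>x. x * l1norm B (k - j) (slice a j z)"] by (simp only: ac_simps)
  finally have "l1norm B (k - Suc j) (slice a (Suc j) z) * real (k choose j)
      \<le> l1norm B (k - j) (slice a j z) * real (k choose Suc j)"
    by (simp only: mult_le_cancel_left_pos of_nat_0_less_iff zero_less_Suc)
  then have "l1norm B (k - Suc j) (slice a (Suc j) z) / real (k choose Suc j)
      \<le> l1norm B (k - j) (slice a j z) / real (k choose j)"
    using pos by (simp add: field_simps)
  also have "\<dots> \<le> l1norm B (k - t) (slice a t z) / real (k choose t)"
    using step by simp
  finally show ?case .
qed simp

text \<open>Each slice \<open>t\<close> up to \<open>j\<close> has at least
  \<open>(k choose t) / (k choose j)\<close> times the norm of slice \<open>j\<close>, and the norms
  of the slices add up to the whole norm.\<close>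

lemma l1norm_ge_slice:
  assumes bal: "balanced (insert a B) k z" and B: "finite B" "a \<notin> B" and j: "j \<le> k"
  shows "l1norm B (k - j) (slice a j z) * (\<Sum>t\<le>j. real (k choose t)) / real (k choose j)
       \<le> l1norm (insert a B) k z"
proof -
  have "l1norm B (k - j) (slice a j z) * (\<Sum>t\<le>j. real (k choose t)) / real (k choose j)
      = (\<Sum>t\<le>j. l1norm B (k - j) (slice a j z) / real (k choose j) * real (k choose t))"
    by (simp add: sum_distrib_left sum_divide_distrib)
  also have "\<dots> \<le> (\<Sum>t\<le>j. l1norm B (k - t) (slice a t z))"
  proof (intro sum_mono)
    fix t assume "t \<in> {..j}"
    then show "l1norm B (k - j) (slice a j z) / real (k choose j) * real (k choose t)
        \<le> l1norm B (k - t) (slice a t z)"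
      using l1norm_slice_div_binomial_antimono[OF bal B, of t j] j
      by (simp add: pos_le_divide_eq)
  qed
  also have "\<dots> \<le> (\<Sum>t\<le>k. l1norm B (k - t) (slice a t z))"
    using j by (intro sum_mono2) (auto simp: l1norm_nonneg)
  finally show ?thesis
    using B by (simp add: l1norm_insert)
qed

section \<open>Binomial estimates\<close>

text \<open>The first and the last \<open>j + 1\<close> coefficients have equal sums by symmetry.
  Together they cover the row, and both contain \<open>k choose j\<close>, whence
  strictness.\<close>

lemma two_mult_sum_binomial_gt:
  assumes "k \<le> 2 * j" "j \<le> k"
  shows "2 ^ k < 2 * (\<Sum>t\<le>j. k choose t)"
proof -
  have sym: "(\<Sum>t\<in>{k-j..k}. k choose t) = (\<Sum>t\<le>j. k choose t)"
    using assms
    by (intro sum.reindex_bij_witness[of _ "\<lambda>t. k - t" "\<lambda>t. k - t"])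
      (auto simp: binomial_symmetric[symmetric])
  have "{..k} = {..j} \<union> {k-j..k}"
    using assms by auto
  then have "2 ^ k = (\<Sum>t\<in>{..j} \<union> {k-j..k}. k choose t)"
    by (simp add: choose_row_sum[symmetric])
  moreover have "(\<Sum>t\<in>{..j} \<union> {k-j..k}. k choose t) + (\<Sum>t\<in>{..j} \<inter> {k-j..k}. k choose t)
      = (\<Sum>t\<le>j. k choose t) + (\<Sum>t\<in>{k-j..k}. k choose t)"
    by (intro sum.union_inter) auto
  moreover have "(\<Sum>t\<in>{j}. k choose t) \<le> (\<Sum>t\<in>{..j} \<inter> {k-j..k}. k choose t)"
    using assms by (intro sum_mono2) auto
  moreover have "k choose j > 0"
    using assms by simp
  ultimately show ?thesis
    unfolding sym by (simp only: sum.insert finite.emptyI sum.empty empty_iff not_False_eq_True)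
qed

text \<open>The left side is one term of the expansion of \<open>(3 + 1) ^ k\<close>.\<close>

lemma binomial_mult_power3_le: "(k choose j) * 3 ^ j \<le> (4::nat) ^ k"
proof (cases "j \<le> k")
  case True
  have "(k choose j) * 3 ^ j \<le> (\<Sum>i\<le>k. of_nat (k choose i) * 3 ^ i * 1 ^ (k - i))"
    using True member_le_sum[of j "{..k}" "\<lambda>i. (k choose i) * 3 ^ i"] by simp
  also have "\<dots> = (3 + 1) ^ k"
    by (rule binomial_ring[symmetric])
  finally show ?thesis by simp
qed (simp add: binomial_eq_0)

text \<open>The numerator exceeds \<open>2 ^ k\<close> and the denominator is at most
  \<open>4 ^ k / 3 ^ j\<close>, so the ratio exceeds \<open>3 ^ j / 2 ^ k\<close>; this is
  exponential in \<open>k\<close> since \<open>j\<close> is above \<open>3 * k / 4\<close>.\<close>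

lemma binomial_tail_ratio_gt:
  assumes j: "3 * k < 4 * j" "j \<le> k"
  shows "2 powr (3 * real k / 16) < 2 * (\<Sum>t\<le>j. real (k choose t)) / real (k choose j)"
proof -
  have c: "real (k choose j) > 0"
    using j by simp
  \<comment> \<open>The constant 3 in the exponent works just because \<open>2 ^ 19 = 524288\<close> is below \<open>3 ^ 12 = 531441\<close>.\<close>
  have "(2::real) powr 19 \<le> 3 powr 12"
    by simp
  then have "(2 powr 19) powr (real k / 16) \<le> ((3::real) powr 12) powr (real k / 16)"
    by (intro powr_mono2) auto
  then have "2 powr (19 * real k / 16) \<le> (3::real) powr (3 * real k / 4)"
    by (simp only: powr_powr) simp
  also have "\<dots> \<le> 3 powr real j"
    using j by (intro powr_mono) auto
  also have "\<dots> = 3 ^ j"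
    by (simp add: powr_realpow)
  finally have a: "2 powr (19 * real k / 16) \<le> (3::real) ^ j" .
  have "2 powr (3 * real k / 16) = 2 powr (19 * real k / 16) / 2 powr real k"
    by (simp add: powr_diff[symmetric] field_simps)
  also have "\<dots> \<le> 3 ^ j / 2 powr real k"
    using a by (intro divide_right_mono) auto
  also have "\<dots> = 3 ^ j / 2 ^ k"
    by (simp add: powr_realpow)
  also have "\<dots> \<le> 2 ^ k / real (k choose j)"
  proof -
    have "real ((k choose j) * 3 ^ j) \<le> real (4 ^ k)"
      using binomial_mult_power3_le[of k j] by (simp only: of_nat_le_iff)
    then have "3 ^ j * real (k choose j) \<le> 2 ^ k * 2 ^ k"
      by (simp add: mult.commute power_mult_distrib[symmetric])
    then show ?thesis
      using c by (simp add: divide_simps)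
  qed
  also have "\<dots> < real (2 * (\<Sum>t\<le>j. k choose t)) / real (k choose j)"
  proof (intro divide_strict_right_mono c)
    have "real (2 ^ k) < real (2 * (\<Sum>t\<le>j. k choose t))"
      using two_mult_sum_binomial_gt[of k j] j by (simp only: of_nat_less_iff)
    then show "2 ^ k < real (2 * (\<Sum>t\<le>j. k choose t))"
      by simp
  qed
  finally show ?thesis
    by simp
qed

section \<open>Lower bound for nonzero solutions\<close>

text \<open>For positive \<open>k\<close> the only unknown is the value at \<open>k\<close> copies
  of \<open>a\<close>, and the only equation says that \<open>k\<close> times it is zero.\<close>

lemma balanced_singleton:
  assumes "balanced {a} k z" "N \<in> multisets_of_size {a} k" "z N \<noteq> 0"
  shows "k = 0"
proof (cases k)
  case (Suc m)
  have "N = replicate_mset k a"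
    using assms(2)
    by (metis (no_types, lifting) multisets_of_size_size multisets_of_size_subset
        set_mset_subset_singletonD)
  then have "z (replicate_mset (Suc m) a) = 0"
    using assms(1) Suc unfolding balanced_def by (auto dest!: spec[of _ "replicate_mset m a"])
  then show ?thesis
    using \<open>N = _\<close> Suc assms(3) by simp
qed

lemma top_slice_exists:
  assumes bal: "balanced (insert a B) k z" and B: "finite B" "a \<notin> B"
    and N: "N \<in> multisets_of_size (insert a B) k" "z N \<noteq> 0"
  obtains j T where "j \<le> k" "balanced B (k - j) (slice a j z)"
    "T \<in> multisets_of_size B (k - j)" "slice a j z T \<noteq> 0"
proof -
  define P where "P = (\<lambda>t. t \<le> k \<and> (\<exists>T\<in>multisets_of_size B (k - t). slice a t z T \<noteq> 0))"
  have "Ex P"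
    using N multisets_of_size_insert[OF B(2), of k] by (auto simp: P_def slice_def)
  moreover have "\<forall>t. P t \<longrightarrow> t \<le> k"
    by (auto simp: P_def)
  ultimately obtain j where j: "P j" "\<And>t. P t \<Longrightarrow> t \<le> j"
    by (metis Nat.ex_has_greatest_nat)
  have "balanced B (k - j) (slice a j z)"
  proof (cases "j = k")
    \<comment> \<open>With no rows left the system has no equations.\<close>
    case True
    then show ?thesis by (simp add: balanced_def)
  next
    case False
    then have "Suc j \<le> k"
      using j(1) by (auto simp: P_def)
    moreover have "\<not> P (Suc j)"
      using j(2) by force
    ultimately show ?thesis
      using bal B by (intro balanced_slice) (auto simp: P_def)
  qed
  then show ?thesis
    using that j(1) by (auto simp: P_def)
qed

text \<open>The induction starts at two symbols, treated directly: the case of large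
  \<open>j\<close> in the step only yields the exponent \<open>3 * k / 16\<close>, which suffices
  from three symbols on. The factor 2 on the right is inherited from the binomial estimate.\<close>

lemma balanced_l1norm_gt:
  assumes "finite A" "card A = Suc (Suc d)" "balanced A k z"
    and "N \<in> multisets_of_size A k" "z N \<noteq> 0"
  shows "2 powr (3 * real k / 4 ^ Suc d) < 2 * l1norm A k z"
  using assms
proof (induction d arbitrary: A k z N)
  case (0 A k z N)
  obtain a b where A: "A = insert a {b}" "a \<notin> {b}"
    using 0(2) by (auto simp: card_Suc_eq)
  obtain j T where j: "j \<le> k" "balanced {b} (k - j) (slice a j z)"
    "T \<in> multisets_of_size {b} (k - j)" "slice a j z T \<noteq> 0"
    using top_slice_exists[of a "{b}" k z N] 0 A by auto
  \<comment> \<open>The top slice is a nonzero solution over one symbol, so it has no rows left and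
    the full binomial row sum is available.\<close>
  have "j = k"
    using balanced_singleton[OF j(2-4)] j(1) by simp
  have row_sum: "(\<Sum>t\<le>k. real (k choose t)) = 2 ^ k"
    using arg_cong[OF choose_row_sum[of k], of real] by simp
  have "2 ^ k \<le> l1norm {b} (k - j) (slice a j z) * 2 ^ k"
    using l1norm_ge_1[of "{b}" T "k - j" "slice a j z"] j by simp
  also have "\<dots> \<le> l1norm A k z"
    using l1norm_ge_slice[of a "{b}" k z j] 0 A \<open>j = k\<close> row_sum by simp
  finally have "2 ^ k \<le> l1norm A k z" .
  moreover have "2 powr (3 * real k / 4 ^ Suc 0) \<le> 2 powr real k"
    by (intro powr_mono) auto
  ultimately show ?case
    by (simp add: powr_realpow) (smt (verit) zero_less_power)
next
  case (Suc d A k z N)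
  obtain a B where A: "A = insert a B" "a \<notin> B" "card B = Suc (Suc d)" "finite B"
    using Suc.prems(1,2) by (metis card_Suc_eq finite_insert)
  obtain j T where j: "j \<le> k" "balanced B (k - j) (slice a j z)"
    "T \<in> multisets_of_size B (k - j)" "slice a j z T \<noteq> 0"
    using top_slice_exists[of a B k z N] Suc.prems A by auto
  show ?case
  proof (cases "4 * j \<le> 3 * k")
    case True
    \<comment> \<open>At least a quarter of the rows remain, which pays for the extra factor 4 in
      the denominator of the exponent.\<close>
    then have "real k \<le> 4 * real (k - j)"
      by linarith
    then have "2 powr (3 * real k / 4 ^ Suc (Suc d)) \<le> 2 powr (3 * real (k - j) / 4 ^ Suc d)"
      by (intro powr_mono) (auto simp: divide_simps)
    also have "\<dots> < 2 * l1norm B (k - j) (slice a j z)"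
      using Suc.IH[OF A(4,3) j(2-4)] .
    also have "\<dots> \<le> 2 * (\<Sum>t\<le>k. l1norm B (k - t) (slice a t z))"
      using j(1) member_le_sum[of j "{..k}" "\<lambda>t. l1norm B (k - t) (slice a t z)"]
      by (simp add: l1norm_nonneg)
    finally show ?thesis
      using A by (simp add: l1norm_insert)
  next
    case False
    define r where "r = (\<Sum>t\<le>j. real (k choose t)) / real (k choose j)"
    \<comment> \<open>There are at least three symbols here, so the denominator is at least
      16.\<close>
    have "(4::real) ^ 2 \<le> 4 ^ Suc (Suc d)"
      by (intro power_increasing) auto
    then have "3 * real k / 4 ^ Suc (Suc d) \<le> 3 * real k / 16"
      by (intro divide_left_mono) auto
    then have "2 powr (3 * real k / 4 ^ Suc (Suc d)) \<le> 2 powr (3 * real k / 16)"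
      by (intro powr_mono) auto
    also have "\<dots> < 2 * r"
      using binomial_tail_ratio_gt[of k j] False j(1) by (simp add: r_def)
    also have "r \<ge> 0"
      by (auto simp: r_def intro!: divide_nonneg_nonneg sum_nonneg)
    then have "2 * r \<le> 2 * (l1norm B (k - j) (slice a j z) * r)"
      using mult_right_mono[OF l1norm_ge_1[of B T "k - j" "slice a j z", OF A(4) j(3,4)], of r] by simp
    also have "\<dots> \<le> 2 * l1norm A k z"
      using l1norm_ge_slice[of a B k z j] Suc.prems A j(1) by (simp add: r_def)
    finally show ?thesis .
  qed
qed

section \<open>Column types and the histograms seen by the players\<close>

text \<open>Zeros are kept, so that every type has as many elements as there are rows and the system
  treats all \<open>d + 1\<close> symbols alike.\<close>

definition col_type :: "nat mat \<Rightarrow> nat \<Rightarrow> nat multiset" where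
  "col_type M c = image_mset (\<lambda>r. M $$ (r, c)) (mset_set {..<dim_row M})"

definition seen_type :: "nat \<Rightarrow> nat mat \<Rightarrow> nat \<Rightarrow> nat multiset" where
  "seen_type i M c = image_mset (\<lambda>r. M $$ (r, c)) (mset_set ({..<dim_row M} - {i}))"

definition col_hist :: "nat mat \<Rightarrow> nat multiset multiset" where
  "col_hist M = image_mset (col_type M) (mset_set {..<dim_col M})"

definition seen_hist :: "nat \<Rightarrow> nat mat \<Rightarrow> nat multiset multiset" where
  "seen_hist i M = image_mset (seen_type i M) (mset_set {..<dim_col M})"

lemma input_matsD:
  assumes "M \<in> input_mats k n d"
  shows "dim_row M = k" "dim_col M = n" "\<And>r c. r < k \<Longrightarrow> c < n \<Longrightarrow> M $$ (r, c) \<le> d"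
  using assms by (auto simp: input_mats_def dest!: subsetD[OF _ elements_matI])

lemma count_image_mset_set:
  assumes "finite S"
  shows "count (image_mset f (mset_set S)) y = (\<Sum>x\<in>S. of_bool (f x = y))"
  using assms by (induction S) auto

lemma count_col_type: "count (col_type M c) s = card {r. r < dim_row M \<and> M $$ (r, c) = s}"
proof -
  have "{r. r < dim_row M \<and> M $$ (r, c) = s} = {..<dim_row M} \<inter> {r. M $$ (r, c) = s}"
    by auto
  then show ?thesis
    by (simp add: col_type_def count_image_mset_set sum_of_bool_eq)
qed

lemma col_type_in:
  assumes "M \<in> input_mats k n d" "c < n"
  shows "col_type M c \<in> multisets_of_size {..d} k"
  using input_matsD[OF assms(1)] assms(2) by (auto simp: col_type_def multisets_of_size_def)

lemma seen_type_in:
  assumes "M \<in> input_mats k n d" "c < n" "i < k"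
  shows "seen_type i M c \<in> multisets_of_size {..d} (k - 1)"
  using input_matsD[OF assms(1)] assms(2,3) by (auto simp: seen_type_def multisets_of_size_def)

lemma col_hist_in:
  assumes "M \<in> input_mats k n d"
  shows "col_hist M \<in> multisets_of_size (multisets_of_size {..d} k) n"
  using col_type_in[OF assms] input_matsD(2)[OF assms]
  by (auto simp: col_hist_def multisets_of_size_def[of "multisets_of_size _ _"])

lemma seen_hist_in:
  assumes "M \<in> input_mats k n d" "i < k"
  shows "seen_hist i M \<in> multisets_of_size (multisets_of_size {..d} (k - 1)) n"
  using seen_type_in[OF assms(1) _ assms(2)] input_matsD(2)[OF assms(1)]
  by (auto simp: seen_hist_def multisets_of_size_def[of "multisets_of_size _ _"])

lemma col_type_eq_add_seen_type:
  assumes "i < dim_row M"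
  shows "col_type M c = add_mset (M $$ (i, c)) (seen_type i M c)"
  unfolding col_type_def seen_type_def using assms
  by (subst mset_set.remove[of _ i]) auto

text \<open>This makes the histogram a legal basis for the message of player
  \<open>i\<close>.\<close>

lemma seen_hist_cong:
  assumes "M \<in> input_mats k n d" "M' \<in> input_mats k n d"
    and rows: "\<forall>j<k. j \<noteq> i \<longrightarrow> row M j = row M' j"
  shows "seen_hist i M = seen_hist i M'"
proof -
  note D = input_matsD[OF assms(1)] input_matsD[OF assms(2)]
  have "M $$ (r, c) = M' $$ (r, c)" if "r < k" "r \<noteq> i" "c < n" for r c
    using rows that D by (metis index_row(1))
  then have "seen_type i M c = seen_type i M' c" if "c < n" for c
    unfolding seen_type_def using that D by (auto intro: image_mset_cong)
  then show ?thesis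
    unfolding seen_hist_def using D by (auto intro: image_mset_cong)
qed

text \<open>Both sides count the pairs of a row and a column such that deleting the row leaves type
  \<open>N\<close> in the column. If the deleted entry is \<open>s\<close>, the column has type
  \<open>add_mset s N\<close> and offers \<open>Suc (count N s)\<close> such rows.\<close>

lemma sum_count_seen_hist:
  assumes M: "M \<in> input_mats k n d"
  shows "(\<Sum>i<k. count (seen_hist i M) N)
       = (\<Sum>s\<le>d. Suc (count N s) * count (col_hist M) (add_mset s N))"
proof -
  note D = input_matsD[OF M]
  have col: "(\<Sum>i<k. of_bool (seen_type i M c = N))
      = (\<Sum>s\<le>d. Suc (count N s) * of_bool (col_type M c = add_mset s N))" if c: "c < n" for c
  proof -
    \<comment> \<open>The indicator is split by the deleted symbol; only
      \<open>s = M $$ (i, c)\<close> contributes.\<close>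
    have "(\<Sum>i<k. of_bool (seen_type i M c = N) :: nat)
        = (\<Sum>i<k. \<Sum>s\<le>d. of_bool (M $$ (i, c) = s) * of_bool (col_type M c = add_mset s N))"
    proof (intro sum.cong refl)
      fix i assume i: "i \<in> {..<k}"
      have "(\<Sum>s\<le>d. of_bool (M $$ (i, c) = s) * of_bool (col_type M c = add_mset s N) :: nat)
          = (\<Sum>s\<le>d. if M $$ (i, c) = s then of_bool (col_type M c = add_mset s N) else 0)"
        by (intro sum.cong) auto
      also have "\<dots> = of_bool (col_type M c = add_mset (M $$ (i, c)) N)"
        using D(3)[of i c] i c by simp
      also have "\<dots> = of_bool (seen_type i M c = N)"
        using col_type_eq_add_seen_type[of i M c] i D(1) by simp
      finally show "of_bool (seen_type i M c = N) = (\<Sum>s\<le>d. of_bool (M $$ (i, c) = s)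
          * of_bool (col_type M c = add_mset s N) :: nat)" by simp
    qed
    also have "\<dots> = (\<Sum>s\<le>d. (\<Sum>i<k. of_bool (M $$ (i, c) = s))
          * of_bool (col_type M c = add_mset s N))"
      by (subst sum.swap) (simp only: sum_distrib_right)
    also have "\<dots> = (\<Sum>s\<le>d. count (col_type M c) s * of_bool (col_type M c = add_mset s N))"
      using D(1) by (simp add: col_type_def count_image_mset_set)
    also have "\<dots> = (\<Sum>s\<le>d. Suc (count N s) * of_bool (col_type M c = add_mset s N))"
      by (intro sum.cong) auto
    finally show ?thesis .
  qed
  have "(\<Sum>i<k. count (seen_hist i M) N) = (\<Sum>c<n. \<Sum>i<k. of_bool (seen_type i M c = N))"
    unfolding seen_hist_def using D(2) by (subst sum.swap) (simp add: count_image_mset_set)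
  also have "\<dots> = (\<Sum>c<n. \<Sum>s\<le>d. Suc (count N s) * of_bool (col_type M c = add_mset s N))"
    using col by simp
  also have "\<dots> = (\<Sum>s\<le>d. Suc (count N s) * count (col_hist M) (add_mset s N))"
    unfolding col_hist_def using D(2)
    by (subst sum.swap) (simp only: count_image_mset_set finite_lessThan sum_distrib_left)
  finally show ?thesis .
qed

section \<open>Recovering the column histogram\<close>

lemma col_hist_eqI:
  assumes "n \<ge> 2" and "d \<ge> 1" and k: "real k \<ge> 4 ^ d * log 2 (real n)"
    and M: "M \<in> input_mats k n d" and M': "M' \<in> input_mats k n d"
    and eq: "\<And>i. i < k \<Longrightarrow> seen_hist i M = seen_hist i M'"
  shows "col_hist M = col_hist M'"
proof (rule ccontr)
  assume neq: "col_hist M \<noteq> col_hist M'"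
  let ?T = "multisets_of_size {..d} k"
  define z where "z N = int (count (col_hist M) N) - int (count (col_hist M') N)" for N
  have fin: "finite ?T"
    by auto
  have bal: "balanced {..d} k z"
    unfolding balanced_def
  proof (intro allI impI)
    fix N
    have "(\<Sum>s\<le>d. Suc (count N s) * count (col_hist M) (add_mset s N))
        = (\<Sum>s\<le>d. Suc (count N s) * count (col_hist M') (add_mset s N))"
      using eq by (simp add: sum_count_seen_hist[OF M, symmetric]
          sum_count_seen_hist[OF M', symmetric] del: mult_Suc)
    from arg_cong[OF this, of int]
    show "(\<Sum>s\<le>d. int (Suc (count N s)) * z (add_mset s N)) = 0"
      by (simp add: z_def right_diff_distrib sum_subtractf del: mult_Suc of_nat_Suc)
  qed
  from neq obtain N where N: "count (col_hist M) N \<noteq> count (col_hist M') N"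
    by (auto simp: multiset_eq_iff)
  then have "N \<in># col_hist M \<or> N \<in># col_hist M'"
    by (metis not_in_iff)
  then have "N \<in> ?T"
    using multisets_of_size_subset[OF col_hist_in[OF M]]
      multisets_of_size_subset[OF col_hist_in[OF M']] by blast
  moreover have "z N \<noteq> 0"
    using N by (simp add: z_def)
  \<comment> \<open>The set \<open>{..d}\<close> has \<open>d + 1\<close> symbols, whereas the lower
    bound is stated for \<open>Suc (Suc d')\<close>.\<close>
  moreover obtain d' where d': "d = Suc d'"
    using \<open>d \<ge> 1\<close> by (cases d) auto
  ultimately have gt: "2 powr (3 * real k / 4 ^ d) < 2 * l1norm {..d} k z"
    using balanced_l1norm_gt[of "{..d}" d' k z N] bal by simp
  have "l1norm {..d} k z
      \<le> (\<Sum>N\<in>?T. real (count (col_hist M) N) + real (count (col_hist M') N))"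
    unfolding l1norm_def by (intro sum_mono) (auto simp: z_def)
  also have "\<dots> = real (\<Sum>N\<in>?T. count (col_hist M) N) + real (\<Sum>N\<in>?T. count (col_hist M') N)"
    by (simp add: sum.distrib)
  also have "\<dots> = 2 * real n"
    by (simp only: sum_count_multisets_of_size[OF fin col_hist_in[OF M]]
        sum_count_multisets_of_size[OF fin col_hist_in[OF M']])
  finally have le: "l1norm {..d} k z \<le> 2 * real n" .
  define x where "x = real k / 4 ^ d"
  have x: "log 2 (real n) \<le> x"
    using k by (simp add: x_def field_simps)
  have "log 2 2 \<le> log 2 (real n)"
    using \<open>n \<ge> 2\<close> by (intro log_mono) auto
  then have "1 \<le> x"
    using x by simp
  \<comment> \<open>Twice the upper bound \<open>2 * n\<close> is compared with twice the norm. The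
    exponent \<open>2 + log 2 n\<close> is at most \<open>3 * x\<close> because \<open>x\<close> is
    at least \<open>log 2 n\<close> and at least 1.\<close>
  have "2 * (2 * real n) = 2 powr 2 * 2 powr (log 2 (real n))"
    using \<open>n \<ge> 2\<close> by simp
  also have "\<dots> = 2 powr (2 + log 2 (real n))"
    by (simp only: powr_add)
  also have "\<dots> \<le> 2 powr (3 * x)"
    using x \<open>1 \<le> x\<close> by (intro powr_mono) auto
  also have "\<dots> < 2 * l1norm {..d} k z"
    using gt by (simp add: x_def)
  finally show False
    using le by simp
qed

text \<open>All required numbers thus depend on the matrix only through its histogram.\<close>

lemma col_count_eq_size_filter_col_hist:
  "col_count d M e = size (filter_mset (\<lambda>T. \<forall>s\<in>{1..d}. count T s = e s) (col_hist M))"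
proof -
  have "filter_mset (\<lambda>T. \<forall>s\<in>{1..d}. count T s = e s) (col_hist M)
      = image_mset (col_type M)
          (mset_set {c\<in>{..<dim_col M}. \<forall>s\<in>{1..d}. count (col_type M c) s = e s})"
    by (simp add: col_hist_def filter_mset_image_mset filter_mset_mset_set)
  then show ?thesis
    by (simp add: col_count_def count_col_type)
qed

section \<open>Encoding the messages and the protocol\<close>

text \<open>The left side counts the histograms of \<open>n\<close> columns over \<open>m\<close>
  types. Encoding a histogram as a whole gets by with \<open>n\<close> values per type, although a
  single count ranges over the \<open>n + 1\<close> values from 0 to \<open>n\<close>. Raising
  \<open>m\<close> by one multiplies the left side by \<open>(m + n) / m\<close>, which is at most
  \<open>n\<close> once \<open>m\<close> and \<open>n\<close> are at least 2.\<close>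

lemma binomial_le_power:
  assumes "n \<ge> 2" "m \<ge> 1"
  shows "(m + n - 1) choose n \<le> n ^ m"
  using assms(2)
proof (induction m rule: dec_induct)
  case base
  then show ?case using assms by simp
next
  case (step m)
  obtain p where m: "m = Suc p"
    using step.hyps by (cases m) auto
  obtain q where n: "n = q + 2"
    using assms by (metis add.commute le_Suc_ex)
  have "m * ((m + n) choose n) = (m + n) * ((m + n - 1) choose n)"
    using binomial_absorb_comp[of "m + n" n] by simp
  also have "\<dots> \<le> (m + n) * n ^ m"
    using step by (intro mult_left_mono) auto
  finally have *: "m * ((m + n) choose n) \<le> (m + n) * n ^ m" .
  show ?case
  proof (cases p)
    \<comment> \<open>For \<open>m = 1\<close> the ratio is \<open>n + 1\<close>, too large; here
      \<open>n + 1 <= n ^ 2\<close> is checked directly.\<close>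
    case 0
    then show ?thesis by (simp add: m n)
  next
    case (Suc p')
    have "m + n \<le> m * n"
      by (simp add: m n Suc algebra_simps)
    then have "(m + n) * n ^ m \<le> m * n * n ^ m"
      by (intro mult_right_mono) auto
    with * have "m * ((m + n) choose n) \<le> m * n * n ^ m"
      by (rule le_trans)
    then have "m * ((m + n) choose n) \<le> m * n ^ Suc m"
      by (simp only: power_Suc mult.assoc)
    then show ?thesis
      using step.hyps by (simp del: power_Suc)
  qed
qed

theorem theorem9:
  fixes n d k :: nat
  assumes "n \<ge> 2" and "d \<ge> 1"
    and "real k \<ge> 4 ^ d * log 2 (real n)"
  shows "\<exists>P :: ((nat \<Rightarrow> nat) \<Rightarrow> nat) sim_protocol.
           sim_NOF_protocol k n d P \<and>
           protocol_cost k n d P \<le> k * ((k + d) choose d) * nat \<lceil>log 2 (real n)\<rceil> \<and>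
           (\<forall>M\<in>input_mats k n d. \<forall>e. (\<Sum>s=1..d. e s) \<le> k \<longrightarrow>
              protocol_output k P M e = col_count d M e)"
proof -
  define L where "L = nat \<lceil>log 2 (real n)\<rceil>"
  define E where "E = multisets_of_size {..d} (k - 1)"
  define m where "m = card E"
  \<comment> \<open>Positivity of the logarithm forces \<open>k >= 1\<close>, so
    \<open>k - 1\<close> does not truncate.\<close>
  have "log 2 (real n) > 0"
    using assms(1) by simp
  then have "real k > 0"
    using assms(3) by (smt (verit) mult_pos_pos zero_less_power)
  then have k: "k \<ge> 1"
    by simp
  have finE: "finite E"
    by (auto simp: E_def)
  have m: "m = (k + d - 1) choose d"
    using k by (simp add: m_def E_def card_multisets_of_size binomial_symmetric[of d] add.commute)
  have "m \<ge> 1"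
    using k unfolding m by (simp add: Suc_le_eq)
  have mle: "m \<le> (k + d) choose d"
    unfolding m by (rule binomial_right_mono) simp
  have "real n \<le> 2 powr real L"
    using assms(1) by (simp add: L_def log_le_iff[symmetric] of_nat_ceiling)
  then have "n \<le> 2 ^ L"
    by (simp add: powr_realpow)
  \<comment> \<open>All messages get the same length, so the prefix condition holds
    automatically.\<close>
  let ?W = "{xs :: bool list. set xs \<subseteq> UNIV \<and> length xs = L * m}"
  have "card (multisets_of_size E n) = (m + n - 1) choose n"
    using finE by (simp add: card_multisets_of_size m_def)
  also have "\<dots> \<le> n ^ m"
    using binomial_le_power \<open>m \<ge> 1\<close> assms(1) by simp
  also have "\<dots> \<le> (2 ^ L) ^ m"
    using \<open>n \<le> 2 ^ L\<close> by (intro power_mono) auto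
  also have "\<dots> = card ?W"
    by (subst card_lists_length_eq) (auto simp: power_mult)
  finally obtain enc where enc: "enc ` multisets_of_size E n \<subseteq> ?W"
      "inj_on enc (multisets_of_size E n)"
    using card_le_inj[of "multisets_of_size E n" ?W]
      finE finite_lists_length_eq[of "UNIV :: bool set" "L * m"] by auto
  define msgs where "msgs M = map (\<lambda>i. enc (seen_hist i M)) [0..<k]" for M
  \<comment> \<open>The referee picks any matrix consistent with the messages; by
    \<open>col_hist_eqI\<close> it has the histogram of the actual input.\<close>
  define P :: "((nat \<Rightarrow> nat) \<Rightarrow> nat) sim_protocol" where
    "P = \<lparr>message = (\<lambda>i M. enc (seen_hist i M)),
          referee = (\<lambda>w. col_count d (SOME M. M \<in> input_mats k n d \<and> msgs M = w))\<rparr>"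
  have all: "all_messages k P M = msgs M" for M
    by (simp add: all_messages_def P_def msgs_def)
  have hist: "seen_hist i M \<in> multisets_of_size E n" if "M \<in> input_mats k n d" "i < k" for i M
    using seen_hist_in[OF that] by (simp add: E_def)
  have len: "length (enc (seen_hist i M)) = L * m" if "M \<in> input_mats k n d" "i < k" for i M
    using hist[OF that] enc(1) by auto
  have "sim_NOF_protocol k n d P"
    unfolding sim_NOF_protocol_def
  proof (intro allI impI ballI conjI)
    fix i M M' assume i: "i < k" and M: "M \<in> input_mats k n d" and M': "M' \<in> input_mats k n d"
    show "message P i M = message P i M'" if "\<forall>j<k. j \<noteq> i \<longrightarrow> row M j = row M' j"
      using seen_hist_cong[OF M M' that] by (simp add: P_def)
    show "message P i M = message P i M'" if "prefix (message P i M) (message P i M')"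
      using that len[OF M i] len[OF M' i]
      by (auto simp: P_def prefix_def)
  qed
  moreover have "protocol_cost k n d P \<le> k * ((k + d) choose d) * L"
    unfolding protocol_cost_def
  proof (intro Max.boundedI finite_imageI finite_input_mats)
    show "(\<lambda>M. sum_list (map length (all_messages k P M))) ` input_mats k n d \<noteq> {}"
      using input_mats_nonempty by simp
    fix x assume "x \<in> (\<lambda>M. sum_list (map length (all_messages k P M))) ` input_mats k n d"
    then obtain M where M: "M \<in> input_mats k n d" "x = sum_list (map length (msgs M))"
      by (auto simp: all)
    have "map length (msgs M) = map (\<lambda>_. L * m) [0..<k]"
      unfolding msgs_def using len[OF M(1)] by simp
    then have "x = k * m * L"
      using M(2) by (simp add: sum_list_triv)
    then show "x \<le> k * ((k + d) choose d) * L"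
      using mle by simp
  qed
  moreover have "protocol_output k P M e = col_count d M e" if M: "M \<in> input_mats k n d" for M e
  proof -
    define M' where "M' = (SOME M'. M' \<in> input_mats k n d \<and> msgs M' = msgs M)"
    have M': "M' \<in> input_mats k n d \<and> msgs M' = msgs M"
      unfolding M'_def by (rule someI[of _ M]) (simp add: M)
    have "seen_hist i M' = seen_hist i M" if i: "i < k" for i
      using M' i hist[OF M i] hist[OF conjunct1[OF M'] i] enc(2)
      by (auto simp: msgs_def inj_on_def)
    then have "col_hist M' = col_hist M"
      using col_hist_eqI[OF assms conjunct1[OF M'] M] by blast
    moreover have "protocol_output k P M e = col_count d M' e"
      unfolding protocol_output_def all by (simp add: P_def M'_def)
    ultimately show ?thesis
      by (simp add: col_count_eq_size_filter_col_hist)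
  qed
  ultimately show ?thesis
    unfolding L_def by blast
qed

end
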